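(* Let $d\ge 1$ and $n\ge 1$ be integers, and let $\mathcal{P}_0,\mathcal{P}_1,\ldots,\mathcal{P}_n\subset\mathbb{R}^d$ be nonempty polytopes. Let $k\in\{0,1,\ldots,n\}$ be such that $\mathcal{P}_k$ is full dimensional, and let $\alpha^\top x\le\beta$ be an inequality describing a facet of $\mathcal{P}_k$. Then the full optimal big-M lifting of $\alpha^\top x\le\beta$ (from $\mathcal{P}_k$) describes a facet of $\mathcal{D}$.
   Context: Write $N=\{1,\ldots,n\}$ and $N_0=\{0,1,\ldots,n\}$. $\mathbf{e}_i$ denotes the $i$-th standard unit vector of $\mathbb{R}^n$ for $i\in N$, and $\mathbf{e}_0$ denotes the zero vector of $\mathbb{R}^n$. Points of $\mathbb{R}^{d+n}$ are written $\begin{pmatrix}x\\ z\end{pmatrix}$ with $x\in\mathbb{R}^d$, $z\in\mathbb{R}^n$. The polytope $\mathcal{D}$ is $$\mathcal{D}:=\operatorname{conv}\left(\bigcup_{i\in N_0}\left\{\begin{pmatrix}x\\ \mathbf{e}_i\end{pmatrix} : x\in\mathcal{P}_i\right\}\right)\subset\mathbb{R}^{d+n}.$$ Terminology: an inequality is valid for a polytope if all points of the polytope satisfy it; the face described by a valid inequality is the set of points of the polytope satisfying it with equality. The dimension of a polytope is one less than the maximum number of affinely independent points in it; a polytope in $\mathbb{R}^m$ is full dimensional if its dimension is $m$; a facet is a face of dimension one less than that of the polytope. Full optimal big-M lifting: let $\alpha^\top x\le\beta$ be valid for $\mathcal{P}_k$, and for $i\in N_0\setminus\{k\}$ put $M_i:=\min\{\beta-\alpha^\top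 x : x\in\mathcal{P}_i\}$. If $k=0$, the full optimal big-M lifting of $\alpha^\top x\le\beta$ is the inequality $$\alpha^\top x+\sum_{i\in N}M_iz_i\le\beta.$$ If $k\in N$, it is the inequality $$\alpha^\top x+\sum_{i\in N\setminus\{k\}}(M_i-M_0)z_i-M_0z_k\le\beta-M_0.$$ *)

theory Defs
  imports "HOL-Analysis.Analysis"
begin

text \<open>A linear inequality \<open>a \<bullet> x \<le> b\<close> is represented by its coefficient vector \<open>a\<close> and
  its right-hand side \<open>b\<close>.\<close>

definition valid_ineq :: "'a::euclidean_space set \<Rightarrow> 'a \<Rightarrow> real \<Rightarrow> bool" where
  "valid_ineq S a b \<longleftrightarrow> (\<forall>x\<in>S. a \<bullet> x \<le> b)"

definition described_face :: "'a::euclidean_space set \<Rightarrow> 'a \<Rightarrow> real \<Rightarrow> 'a set" where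
  "described_face S a b = {x \<in> S. a \<bullet> x = b}"

definition describes_facet :: "'a::euclidean_space set \<Rightarrow> 'a \<Rightarrow> real \<Rightarrow> bool" where
  "describes_facet S a b \<longleftrightarrow> valid_ineq S a b \<and> described_face S a b facet_of S"

definition full_dimensional :: "'a::euclidean_space set \<Rightarrow> bool" where
  "full_dimensional S \<longleftrightarrow> aff_dim S = int DIM('a)"

text \<open>The index set \<open>{1,\<dots>,n}\<close> is the finite type \<open>'n\<close>, and \<open>{0,1,\<dots>,n}\<close> is \<open>'n option\<close>,
  with \<open>None\<close> in the role of the index \<open>0\<close>. The space \<open>\<real>\<^sup>d\<^sup>+\<^sup>n\<close> is the Euclidean product
  space \<open>(real ^ 'd) \<times> (real ^ 'n)\<close>.\<close>

definition unit_vec :: "'n::finite option \<Rightarrow> real ^ 'n" where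
  "unit_vec i = (case i of None \<Rightarrow> 0 | Some j \<Rightarrow> axis j 1)"

definition disj_polytope ::
    "('n::finite option \<Rightarrow> (real ^ 'd::finite) set) \<Rightarrow> ((real ^ 'd) \<times> (real ^ 'n)) set" where
  "disj_polytope P = convex hull (\<Union>i. {(x, unit_vec i) | x. x \<in> P i})"

text \<open>\<open>LEAST\<close> is a genuine minimum (and otherwise unspecified); it exists whenever \<open>P i\<close> is a
  nonempty polytope, see \<open>bigM_minimum\<close> below.\<close>

definition bigM ::
    "('i \<Rightarrow> (real ^ 'd::finite) set) \<Rightarrow> real ^ 'd \<Rightarrow> real \<Rightarrow> 'i \<Rightarrow> real" where
  "bigM P \<alpha> \<beta> i = (LEAST m. m \<in> (\<lambda>x. \<beta> - \<alpha> \<bullet> x) ` P i)"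

definition lifting_coeff ::
    "('n::finite option \<Rightarrow> (real ^ 'd::finite) set) \<Rightarrow> 'n option \<Rightarrow> real ^ 'd \<Rightarrow> real
      \<Rightarrow> (real ^ 'd) \<times> (real ^ 'n)" where
  "lifting_coeff P k \<alpha> \<beta> = (\<alpha>,
     case k of
       None \<Rightarrow> (\<chi> i. bigM P \<alpha> \<beta> (Some i))
     | Some k' \<Rightarrow> (\<chi> i. if i = k' then - bigM P \<alpha> \<beta> None
                          else bigM P \<alpha> \<beta> (Some i) - bigM P \<alpha> \<beta> None))"

definition lifting_rhs ::
    "('n::finite option \<Rightarrow> (real ^ 'd::finite) set) \<Rightarrow> 'n option \<Rightarrow> real ^ 'd \<Rightarrow> real \<Rightarrow> real" where
  "lifting_rhs P k \<alpha> \<beta> = (case k of None \<Rightarrow> \<beta> | Some k' \<Rightarrow> \<beta> - bigM P \<alpha> \<beta> None)"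

lemma bigM_minimum:
  fixes P :: "'i \<Rightarrow> (real ^ 'd::finite) set"
  assumes "polytope (P i)" and "P i \<noteq> {}"
  shows "(\<exists>x\<in>P i. bigM P \<alpha> \<beta> i = \<beta> - \<alpha> \<bullet> x) \<and> (\<forall>x\<in>P i. bigM P \<alpha> \<beta> i \<le> \<beta> - \<alpha> \<bullet> x)"
proof -
  have "continuous_on (P i) (\<lambda>x. \<beta> - \<alpha> \<bullet> x)"
    by (intro continuous_intros)
  then obtain x0 where x0: "x0 \<in> P i" "\<forall>x\<in>P i. \<beta> - \<alpha> \<bullet> x0 \<le> \<beta> - \<alpha> \<bullet> x"
    using continuous_attains_inf[OF polytope_imp_compact[OF assms(1)] assms(2)] by blast
  then have "bigM P \<alpha> \<beta> i = \<beta> - \<alpha> \<bullet> x0"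
    unfolding bigM_def by (intro Least_equality) auto
  with x0 show ?thesis by auto
qed

lemma lifting_None_iff:
  "lifting_coeff P None \<alpha> \<beta> \<bullet> (x, z) \<le> lifting_rhs P None \<alpha> \<beta> \<longleftrightarrow>
     \<alpha> \<bullet> x + (\<Sum>i\<in>UNIV. bigM P \<alpha> \<beta> (Some i) * z $ i) \<le> \<beta>"
  by (simp add: lifting_coeff_def lifting_rhs_def inner_vec_def[of _ z])

lemma lifting_Some_iff:
  "lifting_coeff P (Some k) \<alpha> \<beta> \<bullet> (x, z) \<le> lifting_rhs P (Some k) \<alpha> \<beta> \<longleftrightarrow>
     \<alpha> \<bullet> x + (\<Sum>i\<in>UNIV - {k}. (bigM P \<alpha> \<beta> (Some i) - bigM P \<alpha> \<beta> None) * z $ i)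
       - bigM P \<alpha> \<beta> None * z $ k \<le> \<beta> - bigM P \<alpha> \<beta> None"
  by (simp add: lifting_coeff_def lifting_rhs_def inner_vec_def[of _ z]
      sum.remove[of UNIV k] algebra_simps)

end

theory Submission
  imports Defs
begin

text \<open>
  The lifted inequality is built so that its slack at a point \<open>(x, e\<^sub>i)\<close> with \<open>x \<in> P i\<close> is
  \<open>\<beta> - \<alpha> \<bullet> x - M i\<close> for \<^emph>\<open>every\<close> index \<open>i\<close> (lemma \<open>lifting_at_vertex_slice\<close>). This covers
  \<open>i = k\<close> as well: the facet of \<open>P k\<close> is nonempty, so the least slack \<open>M k\<close> over \<open>P k\<close> is \<open>0\<close>.
  By the choice of \<open>M i\<close> this slack is nonnegative on each slice \<open>P i \<times> {e\<^sub>i}\<close> and vanishes at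
  some point \<open>p i = (x i, e\<^sub>i)\<close> of it; on the slice of \<open>k\<close> it vanishes on the whole facet of
  \<open>P k\<close>. Validity on the convex hull follows at once.

  For the dimension, the affine hull of the described face contains every point \<open>(x, z)\<close> of the
  hyperplane of equality. Indeed, write \<open>z\<close> in barycentric coordinates \<open>\<lambda>\<close> with respect
  to the affinely independent points \<open>e\<^sub>i\<close>. The affine combination of the \<open>p i\<close> with weights \<open>\<lambda> i\<close>
  also lies on the hyperplane and has the same second component, so it differs from \<open>(x, z)\<close> by
  some \<open>(y, 0)\<close> with \<open>\<alpha> \<bullet> y = 0\<close>. This is a direction of the affine hull, because the
  facet of the full-dimensional \<open>P k\<close> spans the hyperplane \<open>\<alpha> \<bullet> x = \<beta>\<close>. A face that spans a
  hyperplane is a facet as soon as some point of the set lies strictly inside the halfspace,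
  and \<open>P k\<close> supplies one.
\<close>

lemma full_dimensional_facet_spans_hyperplane:
  fixes S :: "'a::euclidean_space set"
  assumes full: "full_dimensional S" and facet: "describes_facet S a b"
  shows "a \<noteq> 0" and "affine hull (described_face S a b) = {x. a \<bullet> x = b}"
proof -
  let ?F = "described_face S a b"
  have dimF: "aff_dim ?F = int DIM('a) - 1" and neF: "?F \<noteq> {}"
    using assms by (auto simp: full_dimensional_def describes_facet_def facet_of_def)
  \<comment> \<open>For \<open>a = 0\<close> the described face would be \<open>{}\<close> or all of \<open>S\<close>.\<close>
  show nz: "a \<noteq> 0"
  proof
    assume "a = 0"
    with neF have "?F = S" by (auto simp: described_face_def)
    with dimF full show False by (simp add: full_dimensional_def)
  qed
  have "affine hull ?F \<subseteq> {x. a \<bullet> x = b}"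
    by (rule hull_minimal) (auto simp: described_face_def affine_hyperplane)
  then show "affine hull ?F = {x. a \<bullet> x = b}"
    using neF dimF nz by (intro affine_dim_equal) (auto simp: affine_hyperplane)
qed

text \<open>
  The point off the hyperplane makes the face proper, hence of smaller dimension than \<open>S\<close>; as the
  face already has dimension at least \<open>DIM('a) - 1\<close>, no room is left between the two dimensions.
\<close>

lemma describes_facetI:
  fixes S :: "'a::euclidean_space set"
  assumes conv: "convex S" and valid: "valid_ineq S a b" and nz: "a \<noteq> 0"
    and spans: "{x. a \<bullet> x = b} \<subseteq> affine hull (described_face S a b)"
    and strict: "x \<in> S" "a \<bullet> x \<noteq> b"
  shows "describes_facet S a b"
proof -
  let ?F = "described_face S a b"
  have eq: "?F = S \<inter> {x. a \<bullet> x = b}" by (auto simp: described_face_def)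
  have face: "?F face_of S"
    unfolding eq using conv valid
    by (intro face_of_Int_supporting_hyperplane_le) (auto simp: valid_ineq_def)
  have lt: "aff_dim ?F < aff_dim S"
    using conv face strict by (intro face_of_aff_dim_lt) (auto simp: described_face_def)
  have "int DIM('a) - 1 \<le> aff_dim ?F"
    using aff_dim_subset[OF spans] nz by simp
  moreover have "aff_dim S \<le> int DIM('a)" by (rule aff_dim_le_DIM)
  ultimately have dim: "aff_dim ?F = aff_dim S - 1" using lt by linarith
  have "a \<bullet> ((b / (a \<bullet> a)) *\<^sub>R a) = b" using nz by simp
  then have "affine hull ?F \<noteq> {}" using spans by blast
  then have "?F \<noteq> {}" by simp
  with face dim valid show ?thesis by (simp add: describes_facet_def facet_of_def)
qed

definition bary :: "real ^ 'n \<Rightarrow> 'n::finite option \<Rightarrow> real" where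
  "bary z i = (case i of None \<Rightarrow> 1 - (\<Sum>j\<in>UNIV. z $ j) | Some j \<Rightarrow> z $ j)"

lemma sum_UNIV_option:
  "(\<Sum>i\<in>(UNIV :: 'n::finite option set). f i) = f None + (\<Sum>j\<in>UNIV. f (Some j))"
  by (simp add: UNIV_option_conv sum.reindex)

lemma bary_sum: "(\<Sum>i\<in>UNIV. bary z i) = 1"
  by (simp add: sum_UNIV_option bary_def)

lemma bary_unit_vec: "(\<Sum>i\<in>UNIV. bary z i *\<^sub>R unit_vec i) = z"
  by (simp add: sum_UNIV_option bary_def unit_vec_def vec_eq_iff axis_def if_distrib cong: if_cong)

lemma bigM_facet_index:
  assumes "polytope (P k)" and "P k \<noteq> {}" and "describes_facet (P k) \<alpha> \<beta>"
  shows "bigM P \<alpha> \<beta> k = 0"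
proof -
  obtain x where "x \<in> P k" "\<alpha> \<bullet> x = \<beta>" and "\<forall>x\<in>P k. \<alpha> \<bullet> x \<le> \<beta>"
    using assms(3)
    by (auto simp: describes_facet_def facet_of_def described_face_def valid_ineq_def)
  with bigM_minimum[of P k, OF assms(1,2), of \<alpha> \<beta>] show ?thesis by force
qed

text \<open>
  For \<open>k \<noteq> 0\<close> the substitution \<open>z\<^sub>0 = 1 - \<Sum>i. z\<^sub>i\<close> shifts all coefficients of \<open>z\<close> and the
  right-hand side by \<open>M\<^sub>0\<close>; comparing slacks instead of left-hand sides cancels the shift, and the two cases
  of the definition merge into one formula.
\<close>

lemma lifting_at_vertex_slice:
  assumes "bigM P \<alpha> \<beta> k = 0"
  shows "lifting_coeff P k \<alpha> \<beta> \<bullet> (x, unit_vec i) - lifting_rhs P k \<alpha> \<beta>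
    = \<alpha> \<bullet> x + bigM P \<alpha> \<beta> i - \<beta>"
  using assms
  by (cases k; cases i) (auto simp: lifting_coeff_def lifting_rhs_def unit_vec_def inner_axis)

theorem theorem3:
  fixes P :: "'n::finite option \<Rightarrow> (real ^ 'd::finite) set"
    and k :: "'n option"
    and \<alpha> :: "real ^ 'd" and \<beta> :: real
  assumes "\<And>i. polytope (P i)" and "\<And>i. P i \<noteq> {}"
    and "full_dimensional (P k)"
    and "describes_facet (P k) \<alpha> \<beta>"
  shows "describes_facet (disj_polytope P) (lifting_coeff P k \<alpha> \<beta>) (lifting_rhs P k \<alpha> \<beta>)"
proof -
  let ?a = "lifting_coeff P k \<alpha> \<beta>" and ?b = "lifting_rhs P k \<alpha> \<beta>"
  let ?D = "disj_polytope P" and ?M = "bigM P \<alpha> \<beta>"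
  let ?F = "described_face ?D ?a ?b"
  have Mk: "?M k = 0" using assms by (intro bigM_facet_index)
  note slack = lifting_at_vertex_slice[of P \<alpha> \<beta> k, OF Mk]
  have \<alpha>nz: "\<alpha> \<noteq> 0"
    and span: "affine hull (described_face (P k) \<alpha> \<beta>) = {x. \<alpha> \<bullet> x = \<beta>}"
    using full_dimensional_facet_spans_hyperplane[OF assms(3,4)] by auto
  have M_le: "\<alpha> \<bullet> x + ?M i \<le> \<beta>" if "x \<in> P i" for x i
    using bigM_minimum[of P i, OF assms(1,2), of \<alpha> \<beta>] that by fastforce
  have "\<forall>i. \<exists>x. x \<in> P i \<and> \<alpha> \<bullet> x + ?M i = \<beta>"
  proof
    fix i
    show "\<exists>x. x \<in> P i \<and> \<alpha> \<bullet> x + ?M i = \<beta>"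
      using bigM_minimum[of P i, OF assms(1,2), of \<alpha> \<beta>] by force
  qed
  then obtain xs where xs: "xs i \<in> P i" "\<alpha> \<bullet> xs i + ?M i = \<beta>" for i
    by metis
  have gen: "(x, unit_vec i) \<in> ?D" if "x \<in> P i" for x i
    unfolding disj_polytope_def using that by (intro hull_inc) auto

  have valid: "valid_ineq ?D ?a ?b"
  proof -
    have "?D \<subseteq> {w. ?a \<bullet> w \<le> ?b}"
      unfolding disj_polytope_def
    proof (rule hull_minimal)
      show "(\<Union>i. {(x, unit_vec i) |x. x \<in> P i}) \<subseteq> {w. ?a \<bullet> w \<le> ?b}"
      proof -
        have "?a \<bullet> (x, unit_vec i) \<le> ?b" if "x \<in> P i" for x i
          using M_le[OF that] slack[of x i] by linarith
        then show ?thesis by auto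
      qed
    qed (rule convex_halfspace_le)
    then show ?thesis by (auto simp: valid_ineq_def)
  qed

  have "{w. ?a \<bullet> w = ?b} \<subseteq> affine hull ?F"
  proof
    fix w assume "w \<in> {w. ?a \<bullet> w = ?b}"
    then obtain x z where w: "w = (x, z)" and wb: "?a \<bullet> (x, z) = ?b" by (cases w) auto
    let ?A = "affine hull ?F"
    define p where "p i = (xs i, unit_vec i :: real ^ 'n)" for i
    have pa: "?a \<bullet> p i = ?b" for i
      using slack[of "xs i" i] xs(2)[of i] by (simp add: p_def)
    then have pA: "p i \<in> ?A" for i
      using gen[OF xs(1)] by (intro hull_inc) (simp add: described_face_def p_def)
    define V where "V = (\<lambda>w. - p k + w) ` ?A"
    have V: "subspace V"
      unfolding V_def by (intro affine_diffs_subspace affine_affine_hull pA)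
    define c where "c = (\<Sum>i\<in>UNIV. bary z i *\<^sub>R p i)"
    define y where "y = x - fst c"
    have "snd c = z"
      by (simp add: c_def p_def snd_sum bary_unit_vec)
    then have wcy: "w = c + (y, 0)"
      by (simp add: w y_def prod_eq_iff)
    have "?a \<bullet> c = (\<Sum>i\<in>UNIV. bary z i * ?b)"
      by (simp add: c_def inner_sum_right pa)
    then have "?a \<bullet> c = ?b"
      by (simp add: bary_sum flip: sum_distrib_right)
    moreover have "?a \<bullet> (y, 0) = \<alpha> \<bullet> y"
      by (simp add: lifting_coeff_def)
    ultimately have y0: "\<alpha> \<bullet> y = 0"
      using wb wcy w by (simp add: inner_add_right)

    \<comment> \<open>Transport the span of the facet of \<open>P k\<close> into the slice over \<open>e\<^sub>k\<close>.\<close>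
    have "(\<lambda>x. (x, unit_vec k)) ` described_face (P k) \<alpha> \<beta> \<subseteq> ?F"
    proof -
      have "?a \<bullet> (x, unit_vec k) = ?b" if "\<alpha> \<bullet> x = \<beta>" for x
        using slack[of x k] that Mk by simp
      then show ?thesis using gen by (auto simp: described_face_def)
    qed
    then have "described_face (P k) \<alpha> \<beta> \<subseteq> {x. (x, unit_vec k) \<in> ?A}"
      using hull_subset[of ?F affine] by auto
    moreover have "affine {x. (x, unit_vec k) \<in> ?A}"
    proof (rule affine_def[THEN iffD2], intro ballI allI impI)
      fix x y :: "real ^ 'd" and u v :: real
      assume "x \<in> {x. (x, unit_vec k) \<in> ?A}" "y \<in> {x. (x, unit_vec k) \<in> ?A}" and uv: "u + v = 1"
      then have "u *\<^sub>R (x, unit_vec k) + v *\<^sub>R (y, unit_vec k) \<in> ?A"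
        by (intro mem_affine affine_affine_hull) auto
      moreover have "u *\<^sub>R unit_vec k + v *\<^sub>R unit_vec k = unit_vec k"
        using uv by (simp flip: scaleR_add_left)
      ultimately show "u *\<^sub>R x + v *\<^sub>R y \<in> {x. (x, unit_vec k) \<in> ?A}" by simp
    qed
    ultimately have "{x. \<alpha> \<bullet> x = \<beta>} \<subseteq> {x. (x, unit_vec k) \<in> ?A}"
      unfolding span[symmetric] by (rule hull_minimal)
    moreover have "\<alpha> \<bullet> (xs k + y) = \<beta>"
      using xs(2)[of k] Mk y0 by (simp add: inner_add_right)
    ultimately have "(xs k + y, unit_vec k) \<in> ?A" by auto
    then have yV: "(y, 0) \<in> V"
      by (auto simp: V_def p_def intro!: image_eqI[where x = "(xs k + y, unit_vec k)"])

    \<comment> \<open>The weights sum to \<open>1\<close>, so \<open>c\<close> is \<open>p k\<close> plus a combination of directions in \<open>V\<close>.\<close>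
    have "(\<Sum>i\<in>UNIV. bary z i *\<^sub>R (- p k + p i)) \<in> V"
      using pA by (intro subspace_sum subspace_scale V) (auto simp: V_def)
    moreover have "(\<Sum>i\<in>UNIV. bary z i *\<^sub>R (- p k + p i)) = - p k + c"
      by (simp add: c_def scaleR_diff_right sum_subtractf bary_sum flip: scaleR_sum_left)
    ultimately have "(- p k + c) + (y, 0) \<in> V"
      using yV V by (metis subspace_add)
    then show "w \<in> ?A"
      by (auto simp: V_def wcy add.assoc)
  qed
  moreover obtain x where "x \<in> P k" "\<alpha> \<bullet> x \<noteq> \<beta>"
  proof -
    \<comment> \<open>Otherwise the facet would be all of \<open>P k\<close>.\<close>
    have "described_face (P k) \<alpha> \<beta> \<noteq> P k"
      using assms(4) by (auto simp: describes_facet_def facet_of_def)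
    then show ?thesis using that by (auto simp: described_face_def)
  qed
  then have "(x, unit_vec k) \<in> ?D" "?a \<bullet> (x, unit_vec k) \<noteq> ?b"
    using gen slack[of x k] Mk by auto
  moreover have "?a \<noteq> 0"
    using \<alpha>nz by (simp add: lifting_coeff_def prod_eq_iff)
  moreover have "convex ?D" by (simp add: disj_polytope_def)
  ultimately show ?thesis using valid by (intro describes_facetI)
qed

end
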